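(* Smooth solutions of the compressible Euler equations for a polytropic ideal gas, $$\tau_t-u_x=0,\qquad u_t+p_x=0,\qquad \left(\tfrac12u^2+e\right)_t+(up)_x=0,$$ satisfy $$y'=a_0+a_2y^2,\qquad q^{\backprime}=a_0+a_2q^2,$$ where $$y=m^{-\frac{3(3-\gamma)}{2(3\gamma-1)}}z^{\frac{\gamma+1}{2(\gamma-1)}}\left((u+mz)_x-\frac{2}{3\gamma-1}m_xz\right),$$ $$q=m^{-\frac{3(3-\gamma)}{2(3\gamma-1)}}z^{\frac{\gamma+1}{2(\gamma-1)}}\left((u-mz)_x+\frac{2}{3\gamma-1}m_xz\right),$$ and $$a_0=\frac{K_c}{\gamma}\,m^{-\frac{3(3-\gamma)}{2(3\gamma-1)}}\left[\frac{\gamma-1}{3\gamma-1}\,m\,m_{xx}-\frac{(3\gamma+1)(\gamma-1)}{(3\gamma-1)^2}\,m_x^2\right]z^{\frac{3(\gamma+1)}{2(\gamma-1)}+1},$$ $$a_2=-K_c\,\frac{\gamma+1}{2(\gamma-1)}\,m^{\frac{3(3-\gamma)}{2(3\gamma-1)}}\,z^{\frac{\gamma+1}{2(\gamma-1)}-1}<0.$$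
   Context: Unknowns are functions of $(t,x)$, with one space dimension $x$ in Lagrangian coordinates: $\tau=\rho^{-1}>0$ is the specific volume ($\rho$ is the density), $u$ the velocity, $S$ the entropy, $p$ the pressure, $e$ the internal energy. Polytropic ideal gas: $p=Ke^{S/c_v}\tau^{-\gamma}$ and $e=\frac{1}{\gamma-1}p\tau$, where $K,c_v>0$ and $\gamma>1$ are fixed constants. For $C^1$ solutions the energy equation is equivalently replaced by $S_t=0$. New variables: $z=\frac{2\sqrt{K\gamma}}{\gamma-1}\tau^{-\frac{\gamma-1}{2}}$ and $m=e^{\frac{S}{2c_v}}$. A solution is smooth if $u,\tau,S$ are $C^2$ (equivalently $u,z,m$ are $C^2$ with $z,m$ both positive). The wave speed is $c=\sqrt{-p_\tau}=K_c\,m\,z^{\frac{\gamma+1}{\gamma-1}}$, where $K_c=\sqrt{K\gamma}\,K_\tau^{-\frac{\gamma+1}{2}}>0$ and $K_\tau=\left(\frac{2\sqrt{K\gamma}}{\gamma-1}\right)^{\frac{2}{\gamma-1}}$. Directional derivatives along forward and backward characteristics: $'=\partial_t+c\,\partial_x$ and ${}^{\backprime}=\partial_t-c\,\partial_x$. *)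

theory Defs
  imports "HOL-Analysis.Analysis"
begin

text \<open>All fields are functions of the pair \<open>(t, x)\<close>: time and the one-dimensional Lagrangian
  coordinate.\<close>

definition dt :: "(real \<times> real \<Rightarrow> real) \<Rightarrow> real \<times> real \<Rightarrow> real" where
  "dt f = (\<lambda>(t, x). deriv (\<lambda>s. f (s, x)) t)"

definition dx :: "(real \<times> real \<Rightarrow> real) \<Rightarrow> real \<times> real \<Rightarrow> real" where
  "dx f = (\<lambda>(t, x). deriv (\<lambda>r. f (t, r)) x)"

text \<open>Classical continuous differentiability. It is only used for open \<open>D\<close>. Existence of the
  partial derivatives is required explicitly, because \<open>deriv\<close> is a total operator.\<close>

definition C1_on :: "(real \<times> real) set \<Rightarrow> (real \<times> real \<Rightarrow> real) \<Rightarrow> bool" where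
  "C1_on D f \<longleftrightarrow>
     (\<forall>(t, x) \<in> D. (\<lambda>s. f (s, x)) differentiable (at t) \<and> (\<lambda>r. f (t, r)) differentiable (at x)) \<and>
     continuous_on D (dt f) \<and> continuous_on D (dx f)"

definition C2_on :: "(real \<times> real) set \<Rightarrow> (real \<times> real \<Rightarrow> real) \<Rightarrow> bool" where
  "C2_on D f \<longleftrightarrow> C1_on D f \<and> C1_on D (dt f) \<and> C1_on D (dx f)"

section \<open>Polytropic ideal gas\<close>

text \<open>Equation of state; here \<open>v\<close> is the specific volume and \<open>s\<close> the entropy.\<close>

definition pressure :: "real \<Rightarrow> real \<Rightarrow> real \<Rightarrow> real \<Rightarrow> real \<Rightarrow> real" where
  "pressure K cv \<gamma> v s = K * exp (s / cv) * v powr (- \<gamma>)"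

definition internal_energy :: "real \<Rightarrow> real \<Rightarrow> real \<Rightarrow> real \<Rightarrow> real \<Rightarrow> real" where
  "internal_energy K cv \<gamma> v s = 1 / (\<gamma> - 1) * pressure K cv \<gamma> v s * v"

definition smooth_euler_solution ::
  "real \<Rightarrow> real \<Rightarrow> real \<Rightarrow> (real \<times> real) set \<Rightarrow>
   (real \<times> real \<Rightarrow> real) \<Rightarrow> (real \<times> real \<Rightarrow> real) \<Rightarrow> (real \<times> real \<Rightarrow> real) \<Rightarrow> bool" where
  "smooth_euler_solution K cv \<gamma> D \<tau> u S \<longleftrightarrow>
     C2_on D \<tau> \<and> C2_on D u \<and> C2_on D S \<and>
     (\<forall>P\<in>D. \<tau> P > 0) \<and>
     (let p = (\<lambda>P. pressure K cv \<gamma> (\<tau> P) (S P));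
          e = (\<lambda>P. internal_energy K cv \<gamma> (\<tau> P) (S P))
      in \<forall>P\<in>D. dt \<tau> P - dx u P = 0 \<and>
               dt u P + dx p P = 0 \<and>
               dt (\<lambda>Q. 1 / 2 * (u Q)\<^sup>2 + e Q) P + dx (\<lambda>Q. u Q * p Q) P = 0)"

section \<open>The variables z and m, wave speed and characteristic derivatives\<close>

definition z_var :: "real \<Rightarrow> real \<Rightarrow> (real \<times> real \<Rightarrow> real) \<Rightarrow> real \<times> real \<Rightarrow> real" where
  "z_var K \<gamma> \<tau> P = 2 * sqrt (K * \<gamma>) / (\<gamma> - 1) * \<tau> P powr (- ((\<gamma> - 1) / 2))"

definition m_var :: "real \<Rightarrow> (real \<times> real \<Rightarrow> real) \<Rightarrow> real \<times> real \<Rightarrow> real" where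
  "m_var cv S P = exp (S P / (2 * cv))"

text \<open>The derivative of the pressure in the specific volume is taken at fixed entropy.\<close>

definition wave_speed ::
  "real \<Rightarrow> real \<Rightarrow> real \<Rightarrow> (real \<times> real \<Rightarrow> real) \<Rightarrow> (real \<times> real \<Rightarrow> real) \<Rightarrow> real \<times> real \<Rightarrow> real" where
  "wave_speed K cv \<gamma> \<tau> S P = sqrt (- deriv (\<lambda>v. pressure K cv \<gamma> v (S P)) (\<tau> P))"

definition K_tau :: "real \<Rightarrow> real \<Rightarrow> real" where
  "K_tau K \<gamma> = (2 * sqrt (K * \<gamma>) / (\<gamma> - 1)) powr (2 / (\<gamma> - 1))"

definition K_c :: "real \<Rightarrow> real \<Rightarrow> real" where
  "K_c K \<gamma> = sqrt (K * \<gamma>) * K_tau K \<gamma> powr (- ((\<gamma> + 1) / 2))"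

definition fwd :: "(real \<times> real \<Rightarrow> real) \<Rightarrow> (real \<times> real \<Rightarrow> real) \<Rightarrow> real \<times> real \<Rightarrow> real" where
  "fwd c f P = dt f P + c P * dx f P"

definition bwd :: "(real \<times> real \<Rightarrow> real) \<Rightarrow> (real \<times> real \<Rightarrow> real) \<Rightarrow> real \<times> real \<Rightarrow> real" where
  "bwd c f P = dt f P - c P * dx f P"

section \<open>Gradient variables and Riccati coefficients\<close>

definition y_var ::
  "real \<Rightarrow> (real \<times> real \<Rightarrow> real) \<Rightarrow> (real \<times> real \<Rightarrow> real) \<Rightarrow> (real \<times> real \<Rightarrow> real) \<Rightarrow> real \<times> real \<Rightarrow> real" where
  "y_var \<gamma> u z m P =
     m P powr (- (3 * (3 - \<gamma>) / (2 * (3 * \<gamma> - 1)))) * z P powr ((\<gamma> + 1) / (2 * (\<gamma> - 1))) *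
     (dx (\<lambda>Q. u Q + m Q * z Q) P - 2 / (3 * \<gamma> - 1) * dx m P * z P)"

definition q_var ::
  "real \<Rightarrow> (real \<times> real \<Rightarrow> real) \<Rightarrow> (real \<times> real \<Rightarrow> real) \<Rightarrow> (real \<times> real \<Rightarrow> real) \<Rightarrow> real \<times> real \<Rightarrow> real" where
  "q_var \<gamma> u z m P =
     m P powr (- (3 * (3 - \<gamma>) / (2 * (3 * \<gamma> - 1)))) * z P powr ((\<gamma> + 1) / (2 * (\<gamma> - 1))) *
     (dx (\<lambda>Q. u Q - m Q * z Q) P + 2 / (3 * \<gamma> - 1) * dx m P * z P)"

definition a0_coeff ::
  "real \<Rightarrow> real \<Rightarrow> (real \<times> real \<Rightarrow> real) \<Rightarrow> (real \<times> real \<Rightarrow> real) \<Rightarrow> real \<times> real \<Rightarrow> real" where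
  "a0_coeff K \<gamma> z m P =
     K_c K \<gamma> / \<gamma> * m P powr (- (3 * (3 - \<gamma>) / (2 * (3 * \<gamma> - 1)))) *
     ((\<gamma> - 1) / (3 * \<gamma> - 1) * m P * dx (dx m) P
       - (3 * \<gamma> + 1) * (\<gamma> - 1) / (3 * \<gamma> - 1)\<^sup>2 * (dx m P)\<^sup>2) *
     z P powr (3 * (\<gamma> + 1) / (2 * (\<gamma> - 1)) + 1)"

definition a2_coeff ::
  "real \<Rightarrow> real \<Rightarrow> (real \<times> real \<Rightarrow> real) \<Rightarrow> (real \<times> real \<Rightarrow> real) \<Rightarrow> real \<times> real \<Rightarrow> real" where
  "a2_coeff K \<gamma> z m P =
     - K_c K \<gamma> * ((\<gamma> + 1) / (2 * (\<gamma> - 1))) * m P powr (3 * (3 - \<gamma>) / (2 * (3 * \<gamma> - 1))) *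
     z P powr ((\<gamma> + 1) / (2 * (\<gamma> - 1)) - 1)"

end

theory Submission
  imports Defs
begin

text \<open>For smooth solutions the energy equation reduces to \<open>S\<^sub>t = 0\<close>, and in the variables
  \<open>u\<close>, \<open>z\<close>, \<open>m\<close> the system becomes
  \<open>m\<^sub>t = 0\<close>, \<open>z\<^sub>t = - (c/m) u\<^sub>x\<close>,
  \<open>u\<^sub>t = - m c z\<^sub>x - ((\<gamma>-1)/\<gamma>) c z m\<^sub>x\<close> with \<open>c = K\<^sub>c m z\<^bsup>2b\<^esup>\<close> and
  \<open>b = (\<gamma>+1)/(2(\<gamma>-1))\<close> (lemmas \<open>entropy_stationary\<close>, \<open>has_grad_z_var\<close>, \<open>momentum_in_z_m\<close>,
  \<open>wave_speed_eq\<close>).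

  The two claims are one claim with a sign \<open>s\<close>, \<open>s\<^sup>2 = 1\<close>: the reflection
  \<open>x \<mapsto> -x\<close>, \<open>u \<mapsto> -u\<close> exchanges forward and backward characteristics. Let
  \<open>W = u\<^sub>x + s (m z\<^sub>x + k m\<^sub>x z)\<close> with \<open>k = 1 - 2/(3\<gamma>-1)\<close>. Differentiating the system in \<open>x\<close> expresses the
  derivative of \<open>W\<close> along \<open>\<partial>\<^sub>t + s c \<partial>\<^sub>x\<close> by \<open>x\<close>-derivatives only, provided that mixed
  partial derivatives commute (\<open>C2_on_mixed_partials\<close>). The terms \<open>u\<^sub>x\<^sub>x\<close> and
  \<open>z\<^sub>x\<^sub>x\<close> cancel because \<open>W\<close> belongs to the characteristic field.
  What remains is quadratic in the first derivatives, plus a multiple of \<open>m\<^sub>x\<^sub>x\<close>. The integrating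
  factor \<open>m\<^bsup>-a\<^esup> z\<^bsup>b\<^esup>\<close> has two exponents to absorb the terms linear in \<open>W\<close>, and together
  with the choice of \<open>k\<close> they remove the cross terms and leave a multiple of
  \<open>W\<^sup>2\<close> and a term in \<open>m\<close>, \<open>m\<^sub>x\<close>, \<open>m\<^sub>x\<^sub>x\<close> and \<open>z\<close> alone; this is the Riccati form. The
  cancellation is the polynomial identity \<open>riccati_identity\<close>, and
  \<open>riccati_along_characteristic\<close> connects it with the fields.\<close>

section \<open>Gradients of functions of time and space\<close>

text \<open>The derivative is the total one and not merely a pair of partial derivatives, so that the chain
  rule holds and differentiability of \<open>y\<close> and \<open>q\<close> comes out of the same computation as their
  partial derivatives. Carrying the two components as explicit numbers makes the rules below
  compute them.\<close>
definition has_grad :: "(real \<times> real \<Rightarrow> real) \<Rightarrow> real \<Rightarrow> real \<Rightarrow> real \<times> real \<Rightarrow> bool" where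
  "has_grad f a b P \<longleftrightarrow> (f has_derivative (\<lambda>h. a * fst h + b * snd h)) (at P)"

lemma has_grad_slices:
  assumes "has_grad f a b (t, x)"
  shows "((\<lambda>s. f (s, x)) has_real_derivative a) (at t)"
    and "((\<lambda>r. f (t, r)) has_real_derivative b) (at x)"
proof -
  have D: "(f has_derivative (\<lambda>h. a * fst h + b * snd h)) (at (t, x))"
    using assms by (simp add: has_grad_def)
  have "((\<lambda>s. f (s, x)) has_derivative (\<lambda>s. a * fst (s, 0::real) + b * snd (s, 0::real))) (at t)"
    by (rule has_derivative_compose[where f = "\<lambda>s. (s, x)", OF _ D])
       (auto intro!: derivative_eq_intros)
  then show "((\<lambda>s. f (s, x)) has_real_derivative a) (at t)"
    by (simp add: has_field_derivative_def)
  have "((\<lambda>r. f (t, r)) has_derivative (\<lambda>r. a * fst (0::real, r) + b * snd (0::real, r))) (at x)"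
    by (rule has_derivative_compose[where f = "\<lambda>r. (t, r)", OF _ D])
       (auto intro!: derivative_eq_intros)
  then show "((\<lambda>r. f (t, r)) has_real_derivative b) (at x)"
    by (simp add: has_field_derivative_def)
qed

lemma has_grad_dt: "has_grad f a b P \<Longrightarrow> dt f P = a"
  by (cases P) (auto simp: dt_def dest: has_grad_slices(1) DERIV_imp_deriv)

lemma has_grad_dx: "has_grad f a b P \<Longrightarrow> dx f P = b"
  by (cases P) (auto simp: dx_def dest: has_grad_slices(2) DERIV_imp_deriv)

lemma has_grad_differentiable: "has_grad f a b P \<Longrightarrow> f differentiable (at P)"
  by (auto simp: has_grad_def differentiable_def)

text \<open>Composed product rules deliver components in whatever shape the rules produce; this brings
  them into the wanted one.\<close>
lemma has_grad_eq_rhs: "has_grad f a b P \<Longrightarrow> a = a' \<Longrightarrow> b = b' \<Longrightarrow> has_grad f a' b' P"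
  by simp

lemma has_grad_const: "has_grad (\<lambda>_. k) 0 0 P"
  by (simp add: has_grad_def)

lemma has_grad_add:
  assumes "has_grad f a b P" and "has_grad g a' b' P"
  shows "has_grad (\<lambda>Q. f Q + g Q) (a + a') (b + b') P"
  unfolding has_grad_def
  by (rule has_derivative_eq_rhs[OF has_derivative_add[OF assms[unfolded has_grad_def]]])
     (auto simp: algebra_simps)

lemma has_grad_mult:
  assumes "has_grad f a b P" and "has_grad g a' b' P"
  shows "has_grad (\<lambda>Q. f Q * g Q) (a * g P + f P * a') (b * g P + f P * b') P"
  unfolding has_grad_def
  by (rule has_derivative_eq_rhs[OF has_derivative_mult[OF assms[unfolded has_grad_def]]])
     (auto simp: algebra_simps)

lemma has_grad_cmult:
  "has_grad f a b P \<Longrightarrow> has_grad (\<lambda>Q. k * f Q) (k * a) (k * b) P"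
  using has_grad_mult[OF has_grad_const] by fastforce

lemma has_grad_compose:
  assumes "has_grad f a b P" and "(h has_real_derivative d) (at (f P))"
  shows "has_grad (\<lambda>Q. h (f Q)) (d * a) (d * b) P"
  unfolding has_grad_def
  by (rule has_derivative_eq_rhs[OF has_derivative_compose[OF assms(1)[unfolded has_grad_def]
        assms(2)[unfolded has_field_derivative_def]]])
     (auto simp: algebra_simps)

lemma has_grad_powr:
  assumes "has_grad f a b P" and "f P > 0"
  shows "has_grad (\<lambda>Q. f Q powr r) (r * f P powr r * a / f P) (r * f P powr r * b / f P) P"
  using has_grad_compose[OF assms(1) has_real_derivative_powr[OF assms(2), of r]] assms(2)
  by (simp add: powr_diff)

lemma has_grad_cong:
  assumes "has_grad f a b P" and "open D" and "P \<in> D" and "\<And>Q. Q \<in> D \<Longrightarrow> f Q = g Q"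
  shows "has_grad g a b P"
  using has_derivative_transform_within_open[OF assms(1)[unfolded has_grad_def] assms(2,3,4)]
  by (simp add: has_grad_def)

section \<open>Continuously differentiable functions\<close>

text \<open>Continuous partial derivatives give a total derivative. The neighbourhood
  \<open>X \<times> Y\<close> has \<open>Y\<close> convex so that increments in \<open>x\<close> can be estimated along segments; being
  open, it does not change the limit.\<close>
lemma C1_on_has_grad:
  assumes "open D" and "C1_on D f" and "P \<in> D"
  shows "has_grad f (dt f P) (dx f P) P"
proof -
  obtain t x where P: "P = (t, x)" by (cases P)
  have slices: "((\<lambda>s. f (s, r)) has_real_derivative dt f (q, r)) (at q)"
      "((\<lambda>s. f (q, s)) has_real_derivative dx f (q, r)) (at r)" if "(q, r) \<in> D" for q r
    using assms(2) that
    by (auto simp: C1_on_def dt_def dx_def DERIV_deriv_iff_real_differentiable)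
  obtain X Y where XY: "open X" "open Y" "t \<in> X" "x \<in> Y" "X \<times> Y \<subseteq> D"
    using open_prod_elim[OF assms(1), of P] assms(3) P by (metis mem_Sigma_iff)
  then obtain e where e: "e > 0" "ball x e \<subseteq> Y"
    using openE by blast
  let ?Y = "ball x e"
  have sub: "X \<times> ?Y \<subseteq> D" using XY e by auto
  have cont: "continuous_on (X \<times> ?Y) (\<lambda>(q, r). dx f (q, r) *\<^sub>R id_blinfun)"
  proof -
    have "continuous_on (X \<times> ?Y) (dx f)"
      using assms(2) sub unfolding C1_on_def by (meson continuous_on_subset)
    then show ?thesis
      unfolding case_prod_unfold prod.collapse
      by (rule continuous_on_scaleR[OF _ continuous_on_const])
  qed
  have "((\<lambda>(q, r). f (q, r)) has_derivative
          (\<lambda>(h, k). dt f (t, x) * h + blinfun_apply (dx f (t, x) *\<^sub>R id_blinfun) k))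
        (at (t, x) within X \<times> ?Y)"
  proof (rule has_derivative_partialsI[where f = "\<lambda>q r. f (q, r)" and fx = "\<lambda>h. dt f (t, x) * h"
        and fy = "\<lambda>q r. dx f (q, r) *\<^sub>R id_blinfun"])
    show "((\<lambda>q. f (q, x)) has_derivative (*) (dt f (t, x))) (at t within X)"
      using slices(1)[of t x] assms(3) unfolding has_field_derivative_def P
      by (blast intro: has_derivative_at_withinI)
    show "((\<lambda>r. f (q, r)) has_derivative blinfun_apply (dx f (q, r) *\<^sub>R id_blinfun)) (at r within ?Y)"
      if "q \<in> X" "r \<in> ?Y" for q r
    proof -
      have "blinfun_apply (dx f (q, r) *\<^sub>R id_blinfun) = (*) (dx f (q, r))"
        by (rule ext) (simp add: scaleR_blinfun.rep_eq)
      moreover have "((\<lambda>r. f (q, r)) has_derivative (*) (dx f (q, r))) (at r)"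
        using slices(2)[of q r] sub that unfolding has_field_derivative_def by blast
      ultimately show ?thesis
        by (simp only: has_derivative_at_withinI)
    qed
    show "continuous (at (t, x) within X \<times> ?Y) (\<lambda>(q, r). dx f (q, r) *\<^sub>R id_blinfun)"
    proof -
      have "(t, x) \<in> X \<times> ?Y" using XY(3) e(1) by simp
      then show ?thesis
        using cont unfolding continuous_on_eq_continuous_within by blast
    qed
  qed (use e in auto)
  moreover have "at (t, x) within X \<times> ?Y = at (t, x)"
    using XY e by (intro at_within_open) (auto intro: open_Times)
  ultimately show ?thesis
    by (simp add: has_grad_def P scaleR_blinfun.rep_eq case_prod_unfold)
qed

lemma C1_onI:
  assumes "\<And>P. P \<in> D \<Longrightarrow> has_grad f (a P) (b P) P"
    and "continuous_on D a" and "continuous_on D b"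
  shows "C1_on D f"
  unfolding C1_on_def
proof (intro conjI ballI)
  fix P assume "P \<in> D"
  then have "has_grad f (a P) (b P) P"
    by (rule assms(1))
  then show "case P of (t, x) \<Rightarrow> (\<lambda>s. f (s, x)) differentiable at t \<and> (\<lambda>r. f (t, r)) differentiable at x"
    by (cases P) (metis (no_types, lifting) case_prod_conv has_grad_slices real_differentiable_def)
next
  show "continuous_on D (dt f)"
    using assms(2) by (rule continuous_on_eq) (rule has_grad_dt[OF assms(1), symmetric])
  show "continuous_on D (dx f)"
    using assms(3) by (rule continuous_on_eq) (rule has_grad_dx[OF assms(1), symmetric])
qed

lemma C1_on_continuous:
  assumes "open D" and "C1_on D f"
  shows "continuous_on D f"
proof -
  have "isCont f P" if "P \<in> D" for P
    using C1_on_has_grad[OF assms that] unfolding has_grad_def by (rule has_derivative_continuous)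
  then show ?thesis by (simp add: continuous_at_imp_continuous_on)
qed

lemma C1_on_cong:
  assumes "open D" and "C1_on D f" and "\<And>Q. Q \<in> D \<Longrightarrow> f Q = g Q"
  shows "C1_on D g"
proof (rule C1_onI)
  show "has_grad g (dt f P) (dx f P) P" if "P \<in> D" for P
    by (rule has_grad_cong[OF C1_on_has_grad[OF assms(1,2) that] assms(1) that assms(3)])
  show "continuous_on D (dt f)" "continuous_on D (dx f)"
    using assms(2) by (simp_all add: C1_on_def)
qed

lemma C1_on_mult:
  assumes "open D" and "C1_on D f" and "C1_on D g"
  shows "C1_on D (\<lambda>Q. f Q * g Q)"
proof (rule C1_onI)
  show "has_grad (\<lambda>Q. f Q * g Q) (dt f P * g P + f P * dt g P) (dx f P * g P + f P * dx g P) P"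
    if "P \<in> D" for P
    by (rule has_grad_mult[OF C1_on_has_grad[OF assms(1,2) that] C1_on_has_grad[OF assms(1,3) that]])
  have "continuous_on D f" "continuous_on D g"
    using C1_on_continuous assms by blast+
  then show "continuous_on D (\<lambda>P. dt f P * g P + f P * dt g P)"
    and "continuous_on D (\<lambda>P. dx f P * g P + f P * dx g P)"
    using assms(2,3) unfolding C1_on_def by (intro continuous_on_add continuous_on_mult; blast)+
qed

lemma C1_on_compose:
  assumes "open D" and "C1_on D f"
    and "\<And>P. P \<in> D \<Longrightarrow> (g has_real_derivative g' (f P)) (at (f P))"
    and "continuous_on (f ` D) g'"
  shows "C1_on D (\<lambda>Q. g (f Q))"
proof (rule C1_onI)
  show "has_grad (\<lambda>Q. g (f Q)) (g' (f P) * dt f P) (g' (f P) * dx f P) P" if "P \<in> D" for P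
    by (rule has_grad_compose[where f = f and h = g, OF C1_on_has_grad[OF assms(1,2) that] assms(3)[OF that]])
  have "continuous_on D (\<lambda>P. g' (f P))"
    by (rule continuous_on_compose2[OF assms(4) C1_on_continuous[OF assms(1,2)]]) simp
  then show "continuous_on D (\<lambda>P. g' (f P) * dt f P)" "continuous_on D (\<lambda>P. g' (f P) * dx f P)"
    using assms(2) unfolding C1_on_def by (intro continuous_on_add continuous_on_mult; blast)+
qed

text \<open>The partial derivatives of \<open>g \<circ> f\<close> are \<open>(g' \<circ> f) f\<^sub>t\<close> and
  \<open>(g' \<circ> f) f\<^sub>x\<close>, products of \<open>C\<^sup>1\<close> functions. The derivatives of \<open>g\<close> are required at values
  of \<open>f\<close> only, because real powers are differentiable only away from \<open>0\<close>.\<close>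
lemma C2_on_compose:
  assumes "open D" and "C2_on D f"
    and g: "\<And>P. P \<in> D \<Longrightarrow> (g has_real_derivative g' (f P)) (at (f P))"
    and g': "\<And>P. P \<in> D \<Longrightarrow> (g' has_real_derivative g'' (f P)) (at (f P))"
    and "continuous_on (f ` D) g''"
  shows "C2_on D (\<lambda>Q. g (f Q))"
proof -
  have f: "C1_on D f" "C1_on D (dt f)" "C1_on D (dx f)"
    using assms(2) by (auto simp: C2_on_def)
  have g'f: "C1_on D (\<lambda>Q. g' (f Q))"
    using assms(1) f(1) g' assms(5) by (rule C1_on_compose)
  have grad: "has_grad (\<lambda>Q. g (f Q)) (g' (f P) * dt f P) (g' (f P) * dx f P) P" if "P \<in> D" for P
    by (rule has_grad_compose[where f = f and h = g, OF C1_on_has_grad[OF assms(1) f(1) that] g[OF that]])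
  have "continuous_on (f ` D) g'"
    using g' by (auto intro!: continuous_at_imp_continuous_on DERIV_isCont)
  then have "C1_on D (\<lambda>Q. g (f Q))"
    using C1_on_compose[OF assms(1) f(1) g] by blast
  moreover have "C1_on D (dt (\<lambda>Q. g (f Q)))"
    by (rule C1_on_cong[OF assms(1) C1_on_mult[OF assms(1) g'f f(2)]])
       (metis grad has_grad_dt)
  moreover have "C1_on D (dx (\<lambda>Q. g (f Q)))"
    by (rule C1_on_cong[OF assms(1) C1_on_mult[OF assms(1) g'f f(3)]])
       (metis grad has_grad_dx)
  ultimately show ?thesis by (simp add: C2_on_def)
qed

text \<open>Schwarz's theorem. The double difference of \<open>f\<close> over a square of side \<open>h\<close> is, by two
  applications of the mean value theorem in either order, \<open>h\<^sup>2\<close> times a value of one mixed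
  derivative and also \<open>h\<^sup>2\<close> times a value of the other, both taken inside the square. If
  the two derivatives differed at the corner, continuity would keep their values apart on a small
  square.\<close>
lemma C2_on_mixed_partials:
  assumes "open D" and "C2_on D f" and "P \<in> D"
  shows "dt (dx f) P = dx (dt f) P"
proof (rule ccontr)
  assume neq: "dt (dx f) P \<noteq> dx (dt f) P"
  define \<epsilon> where "\<epsilon> = \<bar>dt (dx f) P - dx (dt f) P\<bar> / 2"
  have "\<epsilon> > 0" using neq by (simp add: \<epsilon>_def)
  obtain t x where P: "P = (t, x)" by (cases P)
  have f: "C1_on D f" "C1_on D (dt f)" "C1_on D (dx f)"
    using assms(2) by (auto simp: C2_on_def)
  have "isCont (dx (dt f)) P" "isCont (dt (dx f)) P"
    using f assms(1,3) by (auto simp: C1_on_def continuous_on_eq_continuous_at)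
  then obtain d1 d2 where d: "d1 > 0" "d2 > 0"
    "\<And>Q. dist Q P < d1 \<Longrightarrow> dist (dx (dt f) Q) (dx (dt f) P) < \<epsilon>"
    "\<And>Q. dist Q P < d2 \<Longrightarrow> dist (dt (dx f) Q) (dt (dx f) P) < \<epsilon>"
    using \<open>\<epsilon> > 0\<close> unfolding continuous_at_eps_delta by metis
  obtain d3 where d3: "d3 > 0" "ball P d3 \<subseteq> D"
    using assms(1,3) openE by blast
  \<comment> \<open>The diameter of the square is at most \<open>2 * h\<close>, so it stays in all three balls.\<close>
  define h where "h = min d1 (min d2 d3) / 3"
  have "h > 0" using d d3 by (simp add: h_def)
  have near: "dist (q, r) P < d1" "dist (q, r) P < d2" "(q, r) \<in> D"
    if "t \<le> q" "q \<le> t + h" "x \<le> r" "r \<le> x + h" for q r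
  proof -
    have "dist (q, r) P \<le> \<bar>q - t\<bar> + \<bar>r - x\<bar>"
      unfolding P dist_prod_def by (simp add: dist_real_def sqrt_sum_squares_le_sum_abs)
    also have "\<dots> \<le> 2 * h" using that by linarith
    also have "\<dots> < min d1 (min d2 d3)"
    proof -
      have "0 < min d1 (min d2 d3)" using d(1,2) d3(1) by simp
      then show ?thesis unfolding h_def by linarith
    qed
    finally show "dist (q, r) P < d1" "dist (q, r) P < d2" "(q, r) \<in> D"
      using d3 by (auto simp: dist_commute)
  qed
  have grad: "has_grad g (dt g Q) (dx g Q) Q" if "C1_on D g" "Q \<in> D" for g Q
    using C1_on_has_grad[OF assms(1) that] .
  obtain q where q: "t < q" "q < t + h"
    "(f (t + h, x + h) - f (t + h, x)) - (f (t, x + h) - f (t, x))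
       = h * (dt f (q, x + h) - dt f (q, x))"
  proof -
    have "\<exists>q. t < q \<and> q < t + h \<and>
       (f (t + h, x + h) - f (t + h, x)) - (f (t, x + h) - f (t, x))
         = (t + h - t) * (dt f (q, x + h) - dt f (q, x))"
      using \<open>h > 0\<close>
      by (intro MVT2[where f = "\<lambda>q. f (q, x + h) - f (q, x)"])
         (auto intro!: DERIV_diff has_grad_slices grad f near)
    then show ?thesis using that by auto
  qed
  obtain r where r: "x < r" "r < x + h"
    "dt f (q, x + h) - dt f (q, x) = h * dx (dt f) (q, r)"
  proof -
    have "\<exists>r. x < r \<and> r < x + h \<and>
       dt f (q, x + h) - dt f (q, x) = (x + h - x) * dx (dt f) (q, r)"
      using \<open>h > 0\<close> q
      by (intro MVT2[where f = "\<lambda>r. dt f (q, r)"])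
         (auto intro!: has_grad_slices(2) grad f near)
    then show ?thesis using that by auto
  qed
  obtain r' where r': "x < r'" "r' < x + h"
    "(f (t + h, x + h) - f (t, x + h)) - (f (t + h, x) - f (t, x))
       = h * (dx f (t + h, r') - dx f (t, r'))"
  proof -
    have "\<exists>r. x < r \<and> r < x + h \<and>
       (f (t + h, x + h) - f (t, x + h)) - (f (t + h, x) - f (t, x))
         = (x + h - x) * (dx f (t + h, r) - dx f (t, r))"
      using \<open>h > 0\<close>
      by (intro MVT2[where f = "\<lambda>r. f (t + h, r) - f (t, r)"])
         (auto intro!: DERIV_diff has_grad_slices grad f near)
    then show ?thesis using that by auto
  qed
  obtain q' where q': "t < q'" "q' < t + h"
    "dx f (t + h, r') - dx f (t, r') = h * dt (dx f) (q', r')"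
  proof -
    have "\<exists>q. t < q \<and> q < t + h \<and>
       dx f (t + h, r') - dx f (t, r') = (t + h - t) * dt (dx f) (q, r')"
      using \<open>h > 0\<close> r'
      by (intro MVT2[where f = "\<lambda>q. dx f (q, r')"])
         (auto intro!: has_grad_slices grad f near)
    then show ?thesis using that by auto
  qed
  have "h * (h * dx (dt f) (q, r)) = h * (h * dt (dx f) (q', r'))"
    unfolding r(3)[symmetric] q'(3)[symmetric] q(3)[symmetric] r'(3)[symmetric] by simp
  then have "dx (dt f) (q, r) = dt (dx f) (q', r')"
    using \<open>h > 0\<close> by simp
  moreover have "dist (dx (dt f) (q, r)) (dx (dt f) P) < \<epsilon>"
    using q r by (intro d near) auto
  moreover have "dist (dt (dx f) (q', r')) (dt (dx f) P) < \<epsilon>"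
    using q' r' by (intro d near) auto
  ultimately show False
    unfolding \<epsilon>_def dist_real_def by argo
qed

section \<open>The Riccati equation for the system in u, z and m\<close>

text \<open>The variables stand for the values at one point of the fields and of their
  \<open>x\<close>-derivatives, and \<open>W\<close> is the gradient variable without its integrating factor. Up to a common
  factor the left-hand side is the derivative of the gradient variable along the characteristic:
  its first line comes from the integrating factor \<open>m\<^bsup>-a\<^esup> z\<^bsup>b\<^esup>\<close>, its second and third
  from \<open>u\<^sub>x\<^sub>t\<close>, its fourth from \<open>(m z\<^sub>x + k m\<^sub>x z)\<^sub>t\<close>, its last from the
  \<open>x\<close>-derivative of \<open>W\<close>. The relations
  between the exponents cancel the mixed terms: the first one kills
  \<open>m\<^sub>x u\<^sub>x\<close>, and all three together kill \<open>m\<^sub>x z\<^sub>x\<close>.\<close>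
lemma riccati_identity:
  fixes s z m mx mxx ux uxx zx zxx a b k g :: real
  assumes "s\<^sup>2 = 1" and "z \<noteq> 0"
    and a: "a = k * (b - 1)" and g: "g * (2 * b + 1) = 2" and k: "2 * k * (b + 1) = 3"
  defines "W \<equiv> ux + s * (m * zx + k * (mx * z))"
  shows "W * (b * (s * m * zx - ux) / z - a * s * mx)
      - (2 * mx * (m * zx) + m\<^sup>2 * (2 * b * zx * zx / z) + m\<^sup>2 * zxx
         + g * (mx * (z * mx) + m * ((2 * b + 1) * zx * mx) + m * (z * mxx)))
      - s * (m * (2 * b * zx / z * ux + uxx) + k * (mx * ux))
      + s * m * (uxx + s * (mx * zx + m * zxx + k * (mxx * z + mx * zx)))
    = ((k - g) * m * mxx + (k\<^sup>2 - g) * mx\<^sup>2) * z - b * W\<^sup>2 / z"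
proof -
  \<comment> \<open>Scaling the first derivatives by \<open>z\<close> turns the identity into one between polynomials.\<close>
  define U v where "U = ux / z" and "v = zx / z"
  have ux: "ux = U * z" and zx: "zx = v * z"
    using assms(2) by (simp_all add: U_def v_def)
  define w where "w = U + s * (m * v + k * mx)"
  have W: "W = w * z"
    by (simp add: W_def w_def ux zx algebra_simps)
  have bk: "b * k = 3 / 2 - k" and bg: "b * g = 1 - g / 2"
    using g k by (simp_all add: algebra_simps)
  have a': "a = 3 / 2 - 2 * k"
    using bk by (simp add: a algebra_simps)
  have div: "b * (s * m * zx - ux) / z = b * (s * m * v - U)" "b * W\<^sup>2 / z = b * w\<^sup>2 * z"
     "2 * b * zx / z = 2 * b * v" "2 * b * zx * zx / z = 2 * b * v\<^sup>2 * z"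
    using assms(2) by (simp_all add: ux zx W power2_eq_square field_simps)
  have "w * (b * (s * m * v - U) - a * s * mx)
      - (2 * mx * (m * v) + m\<^sup>2 * (2 * b * v\<^sup>2) + m\<^sup>2 * d
         + g * (mx * mx + m * ((2 * b + 1) * v * mx) + m * mxx))
      - s * (m * (2 * b * v * U + e) + k * (mx * U))
      + s * m * (e + s * (mx * v + m * d + k * (mxx + mx * v)))
    = ((k - g) * m * mxx + (k\<^sup>2 - g) * mx\<^sup>2) - b * w\<^sup>2" for d e
  proof -
    from assms(1) have "s = 1 \<or> s = -1" by (simp add: power2_eq_1_iff)
    then show ?thesis
      unfolding w_def a' using bk bg by (elim disjE; algebra)
  qed
  note key = this
  have "zxx = zxx / z * z" "uxx = uxx / z * z" using assms(2) by simp_all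
  then obtain d e where zxx: "zxx = d * z" and uxx: "uxx = e * z" by blast
  show ?thesis
    unfolding div left_diff_distrib unfolding W ux zx zxx uxx
    using arg_cong[OF key[of d e], of "\<lambda>r. z * r"]
    by (simp add: algebra_simps)
qed

text \<open>The sign \<open>s\<close> selects the characteristic field: \<open>s = 1\<close> gives \<open>y\<close> along the forward and
  \<open>s = -1\<close> gives \<open>q\<close> along the backward characteristics. The three evolution equations are used
  on all of \<open>D\<close>, since they are differentiated in \<open>x\<close> to obtain the time derivatives of
  \<open>m\<^sub>x\<close>, \<open>z\<^sub>x\<close> and \<open>u\<^sub>x\<close>.\<close>
lemma riccati_along_characteristic:
  fixes u z m :: "real \<times> real \<Rightarrow> real" and K \<gamma> s :: real
  assumes "\<gamma> > 1" and s: "s\<^sup>2 = 1" and D: "open D" and P: "P \<in> D"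
    and C2: "C2_on D u" "C2_on D z" "C2_on D m"
    and pos: "\<And>Q. Q \<in> D \<Longrightarrow> z Q > 0" "\<And>Q. Q \<in> D \<Longrightarrow> m Q > 0"
    and mt: "\<And>Q. Q \<in> D \<Longrightarrow> dt m Q = 0"
    and zt: "\<And>Q. Q \<in> D \<Longrightarrow> dt z Q = - (K_c K \<gamma> * (z Q powr ((\<gamma> + 1) / (\<gamma> - 1)) * dx u Q))"
    and ut: "\<And>Q. Q \<in> D \<Longrightarrow> dt u Q = - (K_c K \<gamma> * (z Q powr ((\<gamma> + 1) / (\<gamma> - 1)) *
               (m Q * m Q * dx z Q + (\<gamma> - 1) / \<gamma> * (m Q * (z Q * dx m Q)))))"
  defines "Y \<equiv> \<lambda>Q. m Q powr (- (3 * (3 - \<gamma>) / (2 * (3 * \<gamma> - 1)))) * z Q powr ((\<gamma> + 1) / (2 * (\<gamma> - 1))) *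
               (dx u Q + s * (m Q * dx z Q + (1 - 2 / (3 * \<gamma> - 1)) * (dx m Q * z Q)))"
  shows "\<exists>A B. has_grad Y A B P \<and>
           A + s * (K_c K \<gamma> * m P * z P powr ((\<gamma> + 1) / (\<gamma> - 1))) * B
             = a0_coeff K \<gamma> z m P + a2_coeff K \<gamma> z m P * (Y P)\<^sup>2"
proof -
  define \<kappa> where "\<kappa> = K_c K \<gamma>"
  define a where "a = 3 * (3 - \<gamma>) / (2 * (3 * \<gamma> - 1))"
  define b where "b = (\<gamma> + 1) / (2 * (\<gamma> - 1))"
  define k where "k = 1 - 2 / (3 * \<gamma> - 1)"
  define g where "g = (\<gamma> - 1) / \<gamma>"
  have b2: "(\<gamma> + 1) / (\<gamma> - 1) = 2 * b"
  proof -
    have "2 * (x / (2 * v)) = x / v" for x v :: real by simp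
    then show ?thesis unfolding b_def by metis
  qed
  have rel: "a = k * (b - 1)" "g * (2 * b + 1) = 2" "2 * k * (b + 1) = 3"
    using assms(1) by (simp_all add: a_def b_def k_def g_def divide_simps) (simp_all add: algebra_simps)
  have C1: "C1_on D u" "C1_on D z" "C1_on D m" "C1_on D (dx u)" "C1_on D (dx z)" "C1_on D (dx m)"
    using C2 by (simp_all add: C2_on_def)
  note grad = C1_on_has_grad[OF D _ P]
  define w where "w = z P powr (2 * b)"
  define mx where "mx = dx m P"
  define mxx where "mxx = dx (dx m) P"
  define ux where "ux = dx u P"
  define uxx where "uxx = dx (dx u) P"
  define zx where "zx = dx z P"
  define zxx where "zxx = dx (dx z) P"
  note jets = mx_def mxx_def ux_def uxx_def zx_def zxx_def
  have zP: "z P > 0" and mP: "m P > 0" using pos P by auto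
  have Gm: "has_grad m 0 mx P"
    using grad[OF C1(3)] mt[OF P] by (simp add: jets)
  have Gz: "has_grad z (- (\<kappa> * (w * ux))) zx P"
    using grad[OF C1(2)] zt[OF P] by (simp add: jets \<kappa>_def w_def b2)
  have Gw: "has_grad (\<lambda>Q. z Q powr (2 * b)) (2 * b * w * - (\<kappa> * (w * ux)) / z P) (2 * b * w * zx / z P) P"
    unfolding w_def by (rule has_grad_powr[OF Gz[unfolded w_def] zP])
  \<comment> \<open>Time derivatives of \<open>m\<^sub>x\<close>, \<open>z\<^sub>x\<close> and \<open>u\<^sub>x\<close>, by commuting the partial derivatives and
    differentiating the evolution equations in \<open>x\<close>.\<close>
  have "has_grad (dt m) 0 0 P"
    by (rule has_grad_cong[OF has_grad_const D P]) (simp add: mt)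
  then have "dt (dx m) P = 0"
    by (simp add: C2_on_mixed_partials[OF D C2(3) P] has_grad_dx)
  then have Gmx: "has_grad (dx m) 0 mxx P"
    using grad[OF C1(6)] by (simp add: jets)
  have ztx: "dt (dx z) P = - \<kappa> * (2 * b * w * zx / z P * ux + w * uxx)"
    unfolding C2_on_mixed_partials[OF D C2(2) P]
    by (rule has_grad_dx, rule has_grad_cong[OF has_grad_cmult[OF has_grad_mult[OF Gw
          grad[OF C1(4), folded jets]]] D P, folded w_def jets])
       (simp add: zt \<kappa>_def b2)
  have Gzx: "has_grad (dx z) (- \<kappa> * (2 * b * w * zx / z P * ux + w * uxx)) zxx P"
    using grad[OF C1(5)] by (simp add: jets ztx)
  have utx: "dt (dx u) P = - \<kappa> * (2 * b * w * zx / z P * (m P * m P * zx + g * (m P * (z P * mx)))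
      + w * ((mx * m P + m P * mx) * zx + m P * m P * zxx
             + g * (mx * (z P * mx) + m P * (zx * mx + z P * mxx))))"
    unfolding C2_on_mixed_partials[OF D C2(1) P]
    by (rule has_grad_dx, rule has_grad_cong[OF has_grad_cmult[OF has_grad_mult[OF Gw
          has_grad_add[OF has_grad_mult[OF has_grad_mult[OF Gm Gm] Gzx]
            has_grad_cmult[OF has_grad_mult[OF Gm has_grad_mult[OF Gz Gmx]]]]]] D P,
          folded w_def jets])
       (simp add: ut \<kappa>_def b2 g_def)
  define W where "W = (\<lambda>Q. dx u Q + s * (m Q * dx z Q + k * (dx m Q * z Q)))"
  have GW: "has_grad W
      (dt (dx u) P + s * (0 * dx z P + m P * (- \<kappa> * (2 * b * w * zx / z P * ux + w * uxx))
         + k * (0 * z P + dx m P * - (\<kappa> * (w * ux)))))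
      (dx (dx u) P + s * (mx * dx z P + m P * zxx + k * (mxx * z P + dx m P * zx))) P"
    unfolding W_def
    by (intro has_grad_add[OF grad[OF C1(4)]] has_grad_cmult has_grad_add[OF has_grad_mult[OF Gm Gzx]]
          has_grad_mult[OF Gmx Gz])
  define M where "M = m P powr (- a)"
  define Z where "Z = z P powr b"
  define Wt where "Wt = dt (dx u) P - \<kappa> * s * (w * (m P * (2 * b * zx / z P * ux + uxx) + k * (mx * ux)))"
  define Wx where "Wx = uxx + s * (mx * zx + m P * zxx + k * (mxx * z P + mx * zx))"
  have GW': "has_grad W Wt Wx P"
    by (rule has_grad_eq_rhs[OF GW]) (simp_all add: Wt_def Wx_def algebra_simps jets)
  define A where "A = (- a * M * 0 / m P * Z + M * (b * Z * - (\<kappa> * (w * ux)) / z P)) * W P + M * Z * Wt"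
  define B where "B = (- a * M * mx / m P * Z + M * (b * Z * zx / z P)) * W P + M * Z * Wx"
  have Y: "Y = (\<lambda>Q. m Q powr (- a) * z Q powr b * W Q)"
    by (simp add: Y_def a_def b_def k_def W_def)
  have "has_grad Y A B P"
    unfolding Y A_def B_def M_def Z_def
    by (intro has_grad_mult has_grad_powr Gm Gz GW' zP mP)
  moreover have "A + s * (\<kappa> * m P * w) * B = a0_coeff K \<gamma> z m P + a2_coeff K \<gamma> z m P * (Y P)\<^sup>2"
  proof -
    have WP: "W P = ux + s * (m P * zx + k * (mx * z P))"
      by (simp add: W_def jets)
    \<comment> \<open>Each of \<open>z\<^sub>t\<close>, \<open>u\<^sub>x\<^sub>t\<close>, \<open>z\<^sub>x\<^sub>t\<close> and \<open>c\<close> contains the factor \<open>\<kappa> * w\<close>, so it comes out in front.\<close>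
    have "A + s * (\<kappa> * m P * w) * B = M * Z * \<kappa> * w *
      (W P * (b * (s * m P * zx - ux) / z P - a * s * mx)
      - (2 * mx * (m P * zx) + (m P)\<^sup>2 * (2 * b * zx * zx / z P) + (m P)\<^sup>2 * zxx
         + g * (mx * (z P * mx) + m P * ((2 * b + 1) * zx * mx) + m P * (z P * mxx)))
      - s * (m P * (2 * b * zx / z P * ux + uxx) + k * (mx * ux))
      + s * m P * (uxx + s * (mx * zx + m P * zxx + k * (mxx * z P + mx * zx))))"
      unfolding A_def B_def Wt_def Wx_def utx using zP mP
      by (simp add: field_simps power2_eq_square)
    also have "\<dots> = M * Z * \<kappa> * w *
       (((k - g) * m P * mxx + (k\<^sup>2 - g) * mx\<^sup>2) * z P - b * (W P)\<^sup>2 / z P)"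
      unfolding WP by (subst riccati_identity[OF s _ rel]) (use zP in auto)
    also have "\<dots> = \<kappa> * M * ((k - g) * m P * mxx + (k\<^sup>2 - g) * mx\<^sup>2) * (Z * w * z P)
       + (- \<kappa> * b * (1 / M) * (Z / z P)) * (M * Z * W P)\<^sup>2"
    \<comment> \<open>Completing \<open>W\<^sup>2\<close> to \<open>Y\<^sup>2 = M\<^sup>2 Z\<^sup>2 W\<^sup>2\<close> consumes \<open>w = Z\<^sup>2\<close> and costs a factor \<open>1 / M\<close>.\<close>
    proof -
      have "w = Z * Z" by (simp add: w_def Z_def powr_add[symmetric])
      moreover have "M > 0" using mP by (simp add: M_def)
      ultimately show ?thesis using zP by (simp add: field_simps power2_eq_square)
    qed
    also have "\<kappa> * M * ((k - g) * m P * mxx + (k\<^sup>2 - g) * mx\<^sup>2) * (Z * w * z P) = a0_coeff K \<gamma> z m P"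
    proof -
      have e: "3 * (\<gamma> + 1) / (2 * (\<gamma> - 1)) = b + 2 * b" by (simp add: b_def add_divide_distrib[symmetric])
      have "z P powr (3 * (\<gamma> + 1) / (2 * (\<gamma> - 1)) + 1) = Z * w * z P"
        unfolding e Z_def w_def powr_add using zP by simp
      moreover have "k - g = 1 / \<gamma> * ((\<gamma> - 1) / (3 * \<gamma> - 1))"
        using assms(1) by (simp add: k_def g_def divide_simps) (simp add: algebra_simps)
      moreover have "k\<^sup>2 - g = - 1 / \<gamma> * ((3 * \<gamma> + 1) * (\<gamma> - 1) / (3 * \<gamma> - 1)\<^sup>2)"
        using assms(1) by (simp add: k_def g_def divide_simps) (simp add: algebra_simps power2_eq_square)
      \<comment> \<open>The bracket of the coefficient, with its two rational functions of \<open>\<gamma>\<close> kept opaque.\<close>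
      moreover have "r / \<gamma> * X * p * p' + - r / \<gamma> * X' * p'' = r / \<gamma> * (X * p * p' - X' * p'')"
        for r X X' p p' p'' by (simp add: algebra_simps)
      ultimately show ?thesis
        by (simp only: a0_coeff_def M_def a_def \<kappa>_def mx_def mxx_def) simp
    qed
    also have "- \<kappa> * b * (1 / M) * (Z / z P) = a2_coeff K \<gamma> z m P"
      using zP mP unfolding a2_coeff_def M_def Z_def a_def[symmetric] b_def[symmetric] \<kappa>_def
      by (simp add: powr_minus powr_diff field_simps)
    also have "M * Z * W P = Y P"
      by (simp add: Y M_def Z_def)
    finally show ?thesis .
  qed
  ultimately show ?thesis
    unfolding \<kappa>_def w_def b2 by blast
qed

section \<open>Reduction of the Euler equations\<close>

lemma has_grad_pressure:
  assumes "has_grad \<tau> \<tau>t \<tau>x P" and "has_grad S St Sx P" and "\<tau> P > 0"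
  shows "has_grad (\<lambda>Q. pressure K cv \<gamma> (\<tau> Q) (S Q))
           (pressure K cv \<gamma> (\<tau> P) (S P) * (St / cv - \<gamma> * \<tau>t / \<tau> P))
           (pressure K cv \<gamma> (\<tau> P) (S P) * (Sx / cv - \<gamma> * \<tau>x / \<tau> P)) P"
proof -
  have "((\<lambda>s. exp (s / cv)) has_real_derivative exp (S P / cv) / cv) (at (S P))"
    unfolding divide_inverse by (auto intro!: derivative_eq_intros)
  note has_grad_compose[where h = "\<lambda>s. exp (s / cv)", OF assms(2) this]
  from has_grad_mult[OF has_grad_cmult[OF this] has_grad_powr[OF assms(1,3)]]
  show ?thesis
    unfolding pressure_def by (rule has_grad_eq_rhs) (simp_all add: algebra_simps)
qed

text \<open>The momentum equation cancels the kinetic part of the energy equation and the mass equation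
  turns \<open>p u\<^sub>x\<close> into \<open>p \<tau>\<^sub>t\<close>, leaving \<open>e\<^sub>t + p \<tau>\<^sub>t = 0\<close>. The equation of state satisfies
  \<open>e\<^sub>\<tau> = - p\<close>, so only the term \<open>e\<^sub>S S\<^sub>t\<close> survives, and \<open>e\<^sub>S > 0\<close>.\<close>
lemma entropy_stationary:
  assumes "K > 0" and "cv > 0" and "\<gamma> > 1" and "open D"
    and sol: "smooth_euler_solution K cv \<gamma> D \<tau> u S" and P: "P \<in> D"
  shows "dt S P = 0"
proof -
  define p where "p = (\<lambda>Q. pressure K cv \<gamma> (\<tau> Q) (S Q))"
  have \<tau>P: "\<tau> P > 0" and "C1_on D \<tau>" "C1_on D u" "C1_on D S"
    and mass: "dt \<tau> P - dx u P = 0" and momentum: "dt u P + dx p P = 0"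
    and energy: "dt (\<lambda>Q. 1 / 2 * (u Q)\<^sup>2 + internal_energy K cv \<gamma> (\<tau> Q) (S Q)) P
           + dx (\<lambda>Q. u Q * p Q) P = 0"
    using sol P by (auto simp: smooth_euler_solution_def C2_on_def Let_def p_def)
  then have G\<tau>: "has_grad \<tau> (dt \<tau> P) (dx \<tau> P) P" and Gu: "has_grad u (dt u P) (dx u P) P"
    and GS: "has_grad S (dt S P) (dx S P) P"
    using C1_on_has_grad[OF assms(4) _ P] by blast+
  have Gp: "has_grad p (p P * (dt S P / cv - \<gamma> * dt \<tau> P / \<tau> P)) (dx p P) P"
    using has_grad_pressure[OF G\<tau> GS \<tau>P] has_grad_dx unfolding p_def by metis
  have "((\<lambda>v. 1 / 2 * v\<^sup>2) has_real_derivative u P) (at (u P))"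
    by (auto intro!: derivative_eq_intros)
  note kinetic = has_grad_compose[where h = "\<lambda>v. 1 / 2 * v\<^sup>2", OF Gu this]
  have cancel: "1 / (\<gamma> - 1) * (r * (\<sigma> / cv - \<gamma> * d / t) * t + r * d) = r * (t * \<sigma> / cv / (\<gamma> - 1) - d)"
    if "t > 0" for r \<sigma> d t :: real
  proof -
    define l where "l = \<gamma> - 1"
    have l: "l \<noteq> 0" "\<gamma> = l + 1" using assms(3) by (simp_all add: l_def)
    show ?thesis
      unfolding l(2) using l(1) that assms(2) by (simp add: field_simps)
  qed
  have internal: "has_grad (\<lambda>Q. internal_energy K cv \<gamma> (\<tau> Q) (S Q))
      (p P * (\<tau> P * dt S P / cv / (\<gamma> - 1) - dt \<tau> P))
      (1 / (\<gamma> - 1) * (dx p P * \<tau> P + p P * dx \<tau> P)) P"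
    unfolding internal_energy_def p_def[symmetric] mult.assoc
    by (rule has_grad_eq_rhs[OF has_grad_cmult[OF has_grad_mult[OF Gp[unfolded p_def] G\<tau>]], folded p_def])
       (simp_all only: p_def cancel[OF \<tau>P])
  have "u P * dt u P + p P * (\<tau> P * dt S P / cv / (\<gamma> - 1) - dt \<tau> P) + (dx u P * p P + u P * dx p P) = 0"
    using energy unfolding has_grad_dt[OF has_grad_add[OF kinetic internal]]
      has_grad_dx[OF has_grad_mult[OF Gu Gp]] .
  moreover have "dx p P = - dt u P" "dx u P = dt \<tau> P"
    using mass momentum by linarith+
  ultimately have "p P * (\<tau> P * dt S P / cv / (\<gamma> - 1)) = 0"
    by (simp add: algebra_simps)
  moreover have "p P > 0"
    using assms(1) \<tau>P by (simp add: p_def pressure_def)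
  ultimately show ?thesis
    using assms(2,3) \<tau>P by simp
qed

text \<open>The constants \<open>K\<^sub>\<tau>\<close> and \<open>K\<^sub>c\<close> are chosen so that the prefactor of \<open>z\<close> drops out. Both sides
  are \<open>c / m\<close>.\<close>
lemma K_c_mult_z_var_powr:
  assumes "K > 0" and "\<gamma> > 1" and "\<tau> P > 0"
  shows "K_c K \<gamma> * z_var K \<gamma> \<tau> P powr ((\<gamma> + 1) / (\<gamma> - 1))
           = sqrt (K * \<gamma>) * \<tau> P powr (- ((\<gamma> + 1) / 2))"
proof -
  define A where "A = 2 * sqrt (K * \<gamma>) / (\<gamma> - 1)"
  have "A > 0" using assms by (simp add: A_def)
  have "- ((\<gamma> - 1) / 2) * ((\<gamma> + 1) / (\<gamma> - 1)) = - ((\<gamma> + 1) / 2)"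
    and "2 / (\<gamma> - 1) * - ((\<gamma> + 1) / 2) = - ((\<gamma> + 1) / (\<gamma> - 1))"
    using assms(2) by (simp_all add: field_simps)
  then have "(\<tau> P powr (- ((\<gamma> - 1) / 2))) powr ((\<gamma> + 1) / (\<gamma> - 1)) = \<tau> P powr (- ((\<gamma> + 1) / 2))"
    and "(A powr (2 / (\<gamma> - 1))) powr (- ((\<gamma> + 1) / 2)) = A powr (- ((\<gamma> + 1) / (\<gamma> - 1)))"
    by (simp_all only: powr_powr)
  moreover have "A powr (- ((\<gamma> + 1) / (\<gamma> - 1))) * A powr ((\<gamma> + 1) / (\<gamma> - 1)) = 1"
    using \<open>A > 0\<close> by (simp add: powr_add[symmetric])
  ultimately show ?thesis
    unfolding K_c_def K_tau_def z_var_def A_def[symmetric]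
    using \<open>A > 0\<close> assms(3) by (simp add: powr_mult)
qed

lemma wave_speed_eq:
  assumes "K > 0" and "\<gamma> > 1" and "\<tau> P > 0"
  shows "wave_speed K cv \<gamma> \<tau> S P
           = K_c K \<gamma> * m_var cv S P * z_var K \<gamma> \<tau> P powr ((\<gamma> + 1) / (\<gamma> - 1))"
proof -
  have "((\<lambda>v. pressure K cv \<gamma> v (S P)) has_real_derivative
          K * exp (S P / cv) * (- \<gamma> * \<tau> P powr (- \<gamma> - 1))) (at (\<tau> P))"
    unfolding pressure_def by (intro DERIV_cmult has_real_derivative_powr assms(3))
  then have "wave_speed K cv \<gamma> \<tau> S P = sqrt (K * exp (S P / cv) * (\<gamma> * \<tau> P powr (- \<gamma> - 1)))"
    unfolding wave_speed_def by (simp add: DERIV_imp_deriv)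
  also have "K * exp (S P / cv) * (\<gamma> * \<tau> P powr (- \<gamma> - 1))
      = (K * \<gamma>) * (m_var cv S P * \<tau> P powr (- ((\<gamma> + 1) / 2)))\<^sup>2"
  proof -
    have "(exp (S P / (2 * cv)))\<^sup>2 = exp (S P / cv)"
      by (simp add: power2_eq_square exp_add[symmetric])
    moreover have "(\<tau> P powr (- ((\<gamma> + 1) / 2)))\<^sup>2 = \<tau> P powr (- \<gamma> - 1)"
      by (simp add: power2_eq_square powr_add[symmetric])
    ultimately show ?thesis
      by (simp add: m_var_def power_mult_distrib)
  qed
  also have "sqrt \<dots> = sqrt (K * \<gamma>) * (m_var cv S P * \<tau> P powr (- ((\<gamma> + 1) / 2)))"
    using assms by (simp add: real_sqrt_mult m_var_def)
  also have "\<dots> = K_c K \<gamma> * m_var cv S P * z_var K \<gamma> \<tau> P powr ((\<gamma> + 1) / (\<gamma> - 1))"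
    using K_c_mult_z_var_powr[of K \<gamma> \<tau> P] assms by (simp add: mult.commute mult.left_commute)
  finally show ?thesis .
qed

lemma has_grad_m_var:
  assumes "has_grad S a b P"
  shows "has_grad (m_var cv S) (m_var cv S P * a / (2 * cv)) (m_var cv S P * b / (2 * cv)) P"
proof -
  have "((\<lambda>s. exp (s / (2 * cv))) has_real_derivative exp (S P / (2 * cv)) / (2 * cv)) (at (S P))"
    unfolding divide_inverse by (auto intro!: derivative_eq_intros)
  from has_grad_compose[where h = "\<lambda>s. exp (s / (2 * cv))", OF assms this]
  show ?thesis
    unfolding m_var_def[abs_def] by simp
qed

lemma has_grad_z_var:
  assumes "has_grad \<tau> a b P" and "\<tau> P > 0" and "\<gamma> > 1"
  shows "has_grad (z_var K \<gamma> \<tau>) (- sqrt (K * \<gamma>) * \<tau> P powr (- ((\<gamma> + 1) / 2)) * a)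
           (- sqrt (K * \<gamma>) * \<tau> P powr (- ((\<gamma> + 1) / 2)) * b) P"
proof -
  have "- ((\<gamma> - 1) / 2) = - ((\<gamma> + 1) / 2) + 1" by (simp add: field_simps)
  then have e: "\<tau> P powr (- ((\<gamma> - 1) / 2)) = \<tau> P powr (- ((\<gamma> + 1) / 2)) * \<tau> P"
    using assms(2) by (simp only: powr_add) simp
  from has_grad_cmult[OF has_grad_powr[OF assms(1,2)]]
  show ?thesis
    unfolding z_var_def[abs_def]
    by (rule has_grad_eq_rhs) (use assms(2,3) in \<open>simp_all add: e divide_simps\<close>)
qed

lemma C2_on_m_var:
  assumes "open D" and "C2_on D S"
  shows "C2_on D (m_var cv S)"
proof -
  have "((\<lambda>s. exp (s / (2 * cv))) has_real_derivative exp (s / (2 * cv)) / (2 * cv)) (at s)"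
    and "((\<lambda>s. exp (s / (2 * cv)) / (2 * cv)) has_real_derivative
           exp (s / (2 * cv)) / (2 * cv) / (2 * cv)) (at s)" for s
    unfolding divide_inverse by (auto intro!: derivative_eq_intros)
  moreover have "continuous_on (S ` D) (\<lambda>s. exp (s / (2 * cv)) / (2 * cv) / (2 * cv))"
    unfolding divide_inverse by (intro continuous_intros)
  ultimately show ?thesis
    unfolding m_var_def[abs_def] by (rule C2_on_compose[OF assms])
qed

lemma C2_on_z_var:
  assumes "open D" and "C2_on D \<tau>" and "\<And>P. P \<in> D \<Longrightarrow> \<tau> P > 0"
  shows "C2_on D (z_var K \<gamma> \<tau>)"
proof -
  define A where "A = 2 * sqrt (K * \<gamma>) / (\<gamma> - 1)"
  define r where "r = - ((\<gamma> - 1) / 2)"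
  have "continuous_on (\<tau> ` D) (\<lambda>v. A * (r * ((r - 1) * v powr (r - 1 - 1))))"
    using assms(3) by (intro continuous_intros) force
  then show ?thesis
    unfolding z_var_def[abs_def] A_def[symmetric] r_def[symmetric]
    by (rule C2_on_compose[where f = \<tau> and g = "\<lambda>v. A * v powr r"
          and g' = "\<lambda>v. A * (r * v powr (r - 1))", OF assms(1,2), rotated 2])
       (intro DERIV_cmult has_real_derivative_powr assms(3); assumption)+
qed

text \<open>The pressure gradient splits into a part along \<open>z\<^sub>x\<close> at fixed entropy, with factor
  \<open>m c\<close>, and a part along \<open>m\<^sub>x\<close> at fixed specific volume, with factor
  \<open>2 p / m = ((\<gamma>-1)/\<gamma>) c z\<close>. Writing \<open>T\<close> for \<open>\<tau>\<^bsup>-(\<gamma>+1)/2\<^esup>\<close>, all the powers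
  of \<open>\<tau>\<close> involved are \<open>T\<close>, \<open>T \<tau>\<close> and \<open>T\<^sup>2 \<tau>\<close>, so the comparison is rational.\<close>
lemma momentum_in_z_m:
  assumes "K > 0" and "cv > 0" and "\<gamma> > 1" and "open D"
    and sol: "smooth_euler_solution K cv \<gamma> D \<tau> u S" and P: "P \<in> D"
  defines "z \<equiv> z_var K \<gamma> \<tau>" and "m \<equiv> m_var cv S"
  shows "dt u P = - (K_c K \<gamma> * (z P powr ((\<gamma> + 1) / (\<gamma> - 1)) *
           (m P * m P * dx z P + (\<gamma> - 1) / \<gamma> * (m P * (z P * dx m P)))))"
proof -
  define p where "p = (\<lambda>Q. pressure K cv \<gamma> (\<tau> Q) (S Q))"
  have \<tau>P: "\<tau> P > 0" and "C1_on D \<tau>" "C1_on D S" and momentum: "dt u P + dx p P = 0"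
    using sol P by (auto simp: smooth_euler_solution_def C2_on_def Let_def p_def)
  then have G\<tau>: "has_grad \<tau> (dt \<tau> P) (dx \<tau> P) P" and GS: "has_grad S (dt S P) (dx S P) P"
    using C1_on_has_grad[OF assms(4) _ P] by blast+
  have px: "dx p P = p P * (dx S P / cv - \<gamma> * dx \<tau> P / \<tau> P)"
    unfolding p_def by (rule has_grad_dx[OF has_grad_pressure[OF G\<tau> GS \<tau>P]])
  have mx: "dx m P = m P * dx S P / (2 * cv)"
    unfolding m_def by (rule has_grad_dx[OF has_grad_m_var[OF GS]])
  define r where "r = sqrt (K * \<gamma>)"
  define T where "T = \<tau> P powr (- ((\<gamma> + 1) / 2))"
  have r2: "r * r = K * \<gamma>"
    using assms(1,3) by (simp add: r_def)
  have zx: "dx z P = - r * T * dx \<tau> P"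
    unfolding z_def r_def T_def by (rule has_grad_dx[OF has_grad_z_var[OF G\<tau> \<tau>P assms(3)]])
  have z: "z P = 2 * r / (\<gamma> - 1) * (T * \<tau> P)"
  proof -
    have "- ((\<gamma> - 1) / 2) = - ((\<gamma> + 1) / 2) + 1" by (simp add: field_simps)
    then have "\<tau> P powr (- ((\<gamma> - 1) / 2)) = T * \<tau> P"
      unfolding T_def using \<tau>P by (simp only: powr_add) simp
    then show ?thesis by (simp add: z_def z_var_def r_def)
  qed
  have pP: "p P = K * (m P)\<^sup>2 * (T\<^sup>2 * \<tau> P)"
  proof -
    have "(m P)\<^sup>2 = exp (S P / cv)"
      by (simp add: m_def m_var_def power2_eq_square exp_add[symmetric])
    moreover have "- \<gamma> = - ((\<gamma> + 1) / 2) + - ((\<gamma> + 1) / 2) + 1" by (simp add: field_simps)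
    then have "\<tau> P powr (- \<gamma>) = T\<^sup>2 * \<tau> P"
      unfolding T_def power2_eq_square using \<tau>P by (simp only: powr_add) simp
    ultimately show ?thesis by (simp add: p_def pressure_def)
  qed
  have "K_c K \<gamma> * (z P powr ((\<gamma> + 1) / (\<gamma> - 1)) *
          (m P * m P * dx z P + (\<gamma> - 1) / \<gamma> * (m P * (z P * dx m P))))
      = r * T * (m P * m P * dx z P + (\<gamma> - 1) / \<gamma> * (m P * (z P * dx m P)))"
    using K_c_mult_z_var_powr[of K \<gamma> \<tau> P] assms(1,3) \<tau>P
    by (simp only: mult.assoc[symmetric] z_def r_def T_def)
  also have "\<dots> = (r * r) * T\<^sup>2 * (m P)\<^sup>2 * (\<tau> P * dx S P / (\<gamma> * cv) - dx \<tau> P)"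
    unfolding zx mx z using assms(2,3) by (simp add: field_simps power2_eq_square)
  also have "\<dots> = dx p P"
    unfolding r2 px pP using assms(2,3) \<tau>P by (simp add: field_simps power2_eq_square)
  finally show ?thesis
    using momentum by linarith
qed

section \<open>Riccati equations along both characteristics\<close>

theorem theorem1p3:
  fixes K cv \<gamma> :: real
    and D :: "(real \<times> real) set"
    and \<tau> u S z m c y q a0 a2 :: "real \<times> real \<Rightarrow> real"
  assumes "K > 0" and "cv > 0" and "\<gamma> > 1"
    and "open D"
    and "smooth_euler_solution K cv \<gamma> D \<tau> u S"
  defines "z \<equiv> z_var K \<gamma> \<tau>"
    and "m \<equiv> m_var cv S"
    and "c \<equiv> wave_speed K cv \<gamma> \<tau> S"
    and "y \<equiv> y_var \<gamma> u z m"
    and "q \<equiv> q_var \<gamma> u z m"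
    and "a0 \<equiv> a0_coeff K \<gamma> z m"
    and "a2 \<equiv> a2_coeff K \<gamma> z m"
  shows "\<forall>P\<in>D. y differentiable (at P) \<and> q differentiable (at P) \<and>
           fwd c y P = a0 P + a2 P * (y P)\<^sup>2 \<and>
           bwd c q P = a0 P + a2 P * (q P)\<^sup>2 \<and>
           a2 P < 0"
proof
  fix P assume P: "P \<in> D"
  note sol = assms(5)
  have \<tau>pos: "\<tau> Q > 0" and mass: "dt \<tau> Q = dx u Q" if "Q \<in> D" for Q
    using sol that by (auto simp: smooth_euler_solution_def Let_def)
  have C2: "C2_on D \<tau>" "C2_on D u" "C2_on D S"
    using sol by (auto simp: smooth_euler_solution_def)
  have C2z: "C2_on D z" and C2m: "C2_on D m"
    unfolding z_def m_def by (rule C2_on_z_var C2_on_m_var assms(4) C2 \<tau>pos; assumption?)+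
  have zpos: "z Q > 0" and mpos: "m Q > 0" if "Q \<in> D" for Q
    using assms(1,3) \<tau>pos[OF that] by (simp_all add: z_def z_var_def m_def m_var_def)
  have grad: "has_grad f (dt f Q) (dx f Q) Q" if "C2_on D f" "Q \<in> D" for f Q
    using C1_on_has_grad[OF assms(4) _ that(2)] that(1) by (simp add: C2_on_def)
  have mt: "dt m Q = 0" if "Q \<in> D" for Q
    using has_grad_dt[OF has_grad_m_var[OF grad[OF C2(3) that]], of cv]
      entropy_stationary[OF assms(1-5) that] by (simp add: m_def)
  have zt: "dt z Q = - (K_c K \<gamma> * (z Q powr ((\<gamma> + 1) / (\<gamma> - 1)) * dx u Q))" if "Q \<in> D" for Q
    using has_grad_dt[OF has_grad_z_var[OF grad[OF C2(1) that] \<tau>pos[OF that] assms(3)], of K]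
      K_c_mult_z_var_powr[of K \<gamma> \<tau> Q] assms(1,3) \<tau>pos[OF that] mass[OF that]
    by (simp add: z_def mult.assoc[symmetric])
  note ut = momentum_in_z_m[OF assms(1-5), folded z_def m_def]
  have c: "c P = K_c K \<gamma> * m P * z P powr ((\<gamma> + 1) / (\<gamma> - 1))"
    unfolding c_def m_def z_def by (rule wave_speed_eq[where \<tau> = \<tau> and P = P, OF assms(1,3) \<tau>pos[OF P]])
  define Y where "Y = (\<lambda>s Q. m Q powr (- (3 * (3 - \<gamma>) / (2 * (3 * \<gamma> - 1)))) *
      z Q powr ((\<gamma> + 1) / (2 * (\<gamma> - 1))) *
      (dx u Q + s * (m Q * dx z Q + (1 - 2 / (3 * \<gamma> - 1)) * (dx m Q * z Q))))"
  have dxW: "dx (\<lambda>Q. u Q + s * (m Q * z Q)) Q = dx u Q + s * (dx m Q * z Q + m Q * dx z Q)"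
    if "Q \<in> D" for s Q
    by (rule has_grad_dx[OF has_grad_add[OF grad[OF C2(2) that] has_grad_cmult[OF
          has_grad_mult[OF grad[OF C2m that] grad[OF C2z that]]]]])
  have yY: "Y 1 Q = y Q" and qY: "Y (- 1) Q = q Q" if "Q \<in> D" for Q
  proof -
    have sum: "dx (\<lambda>Q. u Q + m Q * z Q) Q = dx u Q + (dx m Q * z Q + m Q * dx z Q)"
      and diff: "dx (\<lambda>Q. u Q - m Q * z Q) Q = dx u Q - (dx m Q * z Q + m Q * dx z Q)"
      using dxW[OF that, of 1] dxW[OF that, of "- 1"] by simp_all
    show "Y 1 Q = y Q"
      unfolding Y_def y_def y_var_def sum by (rule arg_cong[where f = "(*) _"]) (simp add: algebra_simps)
    show "Y (- 1) Q = q Q"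
      unfolding Y_def q_def q_var_def diff by (rule arg_cong[where f = "(*) _"]) (simp add: algebra_simps)
  qed
  have riccati: "\<exists>A B. has_grad (Y s) A B P \<and> A + s * c P * B = a0 P + a2 P * (Y s P)\<^sup>2"
    if "s\<^sup>2 = 1" for s
    using riccati_along_characteristic[OF assms(3) that assms(4) P C2(2) C2z C2m zpos mpos mt zt ut]
    unfolding Y_def a0_def a2_def c by simp
  obtain A B where y: "has_grad (Y 1) A B P" "A + c P * B = a0 P + a2 P * (Y 1 P)\<^sup>2"
    using riccati[of 1] by auto
  obtain A' B' where q: "has_grad (Y (- 1)) A' B' P" "A' - c P * B' = a0 P + a2 P * (Y (- 1) P)\<^sup>2"
    using riccati[of "- 1"] by auto
  have Gy: "has_grad y A B P" and Gq: "has_grad q A' B' P"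
    using has_grad_cong[OF y(1) assms(4) P yY] has_grad_cong[OF q(1) assms(4) P qY] by blast+
  have "fwd c y P = a0 P + a2 P * (y P)\<^sup>2" "bwd c q P = a0 P + a2 P * (q P)\<^sup>2"
    using y(2) q(2) unfolding fwd_def bwd_def has_grad_dt[OF Gy] has_grad_dx[OF Gy]
      has_grad_dt[OF Gq] has_grad_dx[OF Gq] yY[OF P] qY[OF P] by blast+
  moreover have "a2 P < 0"
  proof -
    have "K_c K \<gamma> > 0"
      using assms(1,3) by (simp add: K_c_def K_tau_def)
    then show ?thesis
      using assms(3) zpos[OF P] mpos[OF P] by (simp add: a2_def a2_coeff_def)
  qed
  ultimately show "y differentiable (at P) \<and> q differentiable (at P) \<and>
           fwd c y P = a0 P + a2 P * (y P)\<^sup>2 \<and>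
           bwd c q P = a0 P + a2 P * (q P)\<^sup>2 \<and>
           a2 P < 0"
    using has_grad_differentiable[OF Gy] has_grad_differentiable[OF Gq] by blast
qed

end
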